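(* Thompson's group $F$ is isomorphic to a subgroup of $\mathrm{Diff}^{\infty}(I)$, the group of $C^{\infty}$ orientation preserving diffeomorphisms of the interval $I=[0,1]$.
   Context: Thompson's group is $F=\langle \{g_i\}_{i\ge0}\mid g_i^{-1}g_jg_i=g_{j+1}\text{ for }0\le i<j\rangle$; equivalently the group of piecewise linear orientation preserving homeomorphisms of $[0,1]$ with dyadic breakpoints and all slopes powers of two. *)

theory Defs
  imports Complex_Main "HOL-Algebra.Bij"
begin

section \<open>Groups given by generators and relations\<close>

text \<open>
  A word over generators of type \<open>'a\<close> is a list of letters; \<open>(x, True)\<close> stands for the
  generator \<open>x\<close> and \<open>(x, False)\<close> for its formal inverse. A relation \<open>l = r\<close> between two
  words is the pair \<open>(l, r)\<close>.
\<close>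

type_synonym 'a word = "('a \<times> bool) list"

inductive pres_eq :: "('a word \<times> 'a word) set \<Rightarrow> 'a word \<Rightarrow> 'a word \<Rightarrow> bool"
  for R :: "('a word \<times> 'a word) set" where
  refl: "pres_eq R u u"
| sym: "pres_eq R u v \<Longrightarrow> pres_eq R v u"
| trans: "pres_eq R u v \<Longrightarrow> pres_eq R v w \<Longrightarrow> pres_eq R u w"
| cancel: "pres_eq R (u @ [(x, b), (x, \<not> b)] @ v) (u @ v)"
| rel: "(l, r) \<in> R \<Longrightarrow> pres_eq R (u @ l @ v) (u @ r @ v)"

definition presented_group :: "('a word \<times> 'a word) set \<Rightarrow> 'a word set monoid" where
  "presented_group R =
    \<lparr>carrier = UNIV // {(u, v). pres_eq R u v},
     mult = \<lambda>A B. {w. \<exists>u\<in>A. \<exists>v\<in>B. pres_eq R w (u @ v)},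
     one = {w. pres_eq R w []}\<rparr>"

lemma pres_eq_append:
  assumes "pres_eq R u u'" and "pres_eq R v v'"
  shows "pres_eq R (u @ v) (u' @ v')"
proof -
  have ctx: "pres_eq R (p @ x @ q) (p @ y @ q)" if "pres_eq R x y" for x y p q
    using that
  proof (induction rule: pres_eq.induct)
    case (cancel u x b v)
    then show ?case
      using pres_eq.cancel[of R "p @ u" x b "v @ q"] by simp
  next
    case (rel l r u v)
    then show ?case
      using pres_eq.rel[of l r R "p @ u" "v @ q"] by simp
  next
    case (refl u)
    show ?case by (rule pres_eq.refl)
  next
    case (sym u v)
    show ?case by (rule pres_eq.sym) fact
  next
    case (trans u v w)
    show ?case by (rule pres_eq.trans) fact+
  qed
  have "pres_eq R (u @ v) (u' @ v)"
    using ctx[OF assms(1), of "[]" v] by simp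
  moreover have "pres_eq R (u' @ v) (u' @ v')"
    using ctx[OF assms(2), of u' "[]"] by simp
  ultimately show ?thesis by (rule pres_eq.trans)
qed

lemma pres_eq_class: "{w. pres_eq R w u} = {w. pres_eq R w v} \<longleftrightarrow> pres_eq R u v"
proof
  assume "{w. pres_eq R w u} = {w. pres_eq R w v}"
  then show "pres_eq R u v"
    using pres_eq.refl[of R u] by blast
next
  assume uv: "pres_eq R u v"
  show "{w. pres_eq R w u} = {w. pres_eq R w v}"
    by (intro Collect_cong iffI)
      (erule pres_eq.trans, rule uv, erule pres_eq.trans, rule pres_eq.sym, rule uv)
qed

lemma presented_group_carrier:
  "A \<in> carrier (presented_group R) \<longleftrightarrow> (\<exists>u. A = {w. pres_eq R w u})"
proof -
  have "{(u, v). pres_eq R u v} `` {u} = {w. pres_eq R w u}" for u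
    unfolding Image_singleton mem_Collect_eq case_prod_conv
    by (intro Collect_cong iffI) (erule pres_eq.sym)+
  then show ?thesis
    by (auto simp: presented_group_def quotient_def)
qed

lemma presented_group_one: "\<one>\<^bsub>presented_group R\<^esub> = {w. pres_eq R w []}"
  by (simp add: presented_group_def)

lemma presented_group_mult:
  "{w. pres_eq R w u} \<otimes>\<^bsub>presented_group R\<^esub> {w. pres_eq R w v} = {w. pres_eq R w (u @ v)}"
proof -
  have "(\<exists>a\<in>{w. pres_eq R w u}. \<exists>b\<in>{w. pres_eq R w v}. pres_eq R w (a @ b))
      \<longleftrightarrow> pres_eq R w (u @ v)" for w
  proof
    assume "\<exists>a\<in>{w. pres_eq R w u}. \<exists>b\<in>{w. pres_eq R w v}. pres_eq R w (a @ b)"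
    then obtain a b where "pres_eq R a u" "pres_eq R b v" and ab: "pres_eq R w (a @ b)"
      by auto
    then have "pres_eq R (a @ b) (u @ v)"
      by (intro pres_eq_append)
    with ab show "pres_eq R w (u @ v)"
      by (rule pres_eq.trans)
  next
    assume "pres_eq R w (u @ v)"
    then show "\<exists>a\<in>{w. pres_eq R w u}. \<exists>b\<in>{w. pres_eq R w v}. pres_eq R w (a @ b)"
      by (intro bexI[of _ u] bexI[of _ v]) (simp_all add: pres_eq.refl)
  qed
  then show ?thesis
    by (simp add: presented_group_def)
qed

lemma word_inverse:
  "pres_eq R (rev (map (\<lambda>(x, b). (x, \<not> b)) u) @ u) []"
proof (induction u)
  case Nil
  show ?case by (simp add: pres_eq.refl)
next
  case (Cons a u)
  obtain x b where a: "a = (x, b)" by (cases a)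
  have "pres_eq R (rev (map (\<lambda>(x, b). (x, \<not> b)) u) @ [(x, \<not> b), (x, \<not> \<not> b)] @ u)
          (rev (map (\<lambda>(x, b). (x, \<not> b)) u) @ u)"
    by (rule pres_eq.cancel)
  then show ?case
    using pres_eq.trans[OF _ Cons.IH] by (simp add: a)
qed

lemma group_presented_group: "group (presented_group R)"
proof (rule groupI)
  show "\<one>\<^bsub>presented_group R\<^esub> \<in> carrier (presented_group R)"
    by (auto simp: presented_group_carrier presented_group_one)
next
  fix A assume "A \<in> carrier (presented_group R)"
  then obtain u where A: "A = {w. pres_eq R w u}"
    by (auto simp: presented_group_carrier)
  show "\<one>\<^bsub>presented_group R\<^esub> \<otimes>\<^bsub>presented_group R\<^esub> A = A"
    by (simp add: A presented_group_one presented_group_mult)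
  let ?v = "rev (map (\<lambda>(x, b). (x, \<not> b)) u)"
  have "{w. pres_eq R w ?v} \<otimes>\<^bsub>presented_group R\<^esub> A = \<one>\<^bsub>presented_group R\<^esub>"
    using word_inverse[of R u]
    by (simp add: A presented_group_one presented_group_mult pres_eq_class)
  then show "\<exists>B\<in>carrier (presented_group R).
      B \<otimes>\<^bsub>presented_group R\<^esub> A = \<one>\<^bsub>presented_group R\<^esub>"
    by (intro bexI[of _ "{w. pres_eq R w ?v}"]) (auto simp: presented_group_carrier)
qed (auto simp: presented_group_carrier presented_group_mult)

section \<open>Thompson's group\<close>

text \<open>The relations \<open>g\<^sub>i\<inverse> g\<^sub>j g\<^sub>i = g\<^sub>j\<^sub>+\<^sub>1\<close> for \<open>0 \<le> i < j\<close>.\<close>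

definition thompson_relations :: "(nat word \<times> nat word) set" where
  "thompson_relations =
    {([(i, False), (j, True), (i, True)], [(j + 1, True)]) | i j. i < j}"

definition thompson_F :: "nat word set monoid" where
  "thompson_F = presented_group thompson_relations"

section \<open>Smooth diffeomorphisms of the unit interval\<close>

text \<open>
  \<open>D k\<close> is the \<open>k\<close>-th derivative of \<open>f\<close> on \<open>S\<close>. Derivatives are taken within \<open>S\<close>,
  so for \<open>S = {0..1}\<close> they are one-sided at the endpoints.
\<close>

definition smooth_on :: "real set \<Rightarrow> (real \<Rightarrow> real) \<Rightarrow> bool" where
  "smooth_on S f \<longleftrightarrow>
    (\<exists>D :: nat \<Rightarrow> real \<Rightarrow> real. D 0 = f \<and>
      (\<forall>k. \<forall>x\<in>S. (D k has_real_derivative D (Suc k) x) (at x within S)))"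

text \<open>
  Elements are extensional functions (undefined outside \<open>{0..1}\<close>), so that they are
  determined by their values on the interval; the product of \<open>g\<close> and \<open>f\<close> is \<open>g \<circ> f\<close>.
\<close>

definition Diff_infty :: "(real \<Rightarrow> real) monoid" where
  "Diff_infty = (BijGroup {0..1})
    \<lparr>carrier := {f \<in> Bij {0..1}. strict_mono_on {0..1} f \<and>
       smooth_on {0..1} f \<and> smooth_on {0..1} (inv_into {0..1} f)}\<rparr>"

end

theory Submission
  imports Defs "HOL-Algebra.Coset"
begin

text \<open>
  Let \<open>B\<close> fix \<open>[0, b]\<close> pointwise and let \<open>A\<close> agree with \<open>B\<close> on \<open>[c, 1]\<close>. If \<open>A\<close> moves \<open>c\<close> below \<open>b\<close>
  in two steps, then \<open>A\<close> and the conjugates of \<open>B\<close> by powers of \<open>A\<close> satisfy the relations of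
  Thompson's group. Smooth \<open>A\<close> and \<open>B\<close> of this kind are obtained by subtracting bumps built from
  \<open>exp (- 1 / x)\<close> from the identity and taking high powers.

  The resulting homomorphism is injective: every element of the group is a fraction of positive
  words, all generators push points to the left, and the set of points fixed by a positive word
  determines its least index. The generator of that index can be moved to the front of the word
  and cancelled.
\<close>

section \<open>Smooth functions\<close>

text \<open>Recursion on the order, with only one derivative chosen at a time, lets the product,
  chain and inverse rules be proved by induction. Nothing here needs derivatives within
  \<open>S\<close> to be unique, so \<open>S\<close> may be arbitrary.\<close>

fun diff_upto :: "nat \<Rightarrow> real set \<Rightarrow> (real \<Rightarrow> real) \<Rightarrow> bool" where
  "diff_upto 0 S f \<longleftrightarrow> True"
| "diff_upto (Suc n) S f \<longleftrightarrow>
    (\<exists>f'. (\<forall>x\<in>S. (f has_real_derivative f' x) (at x within S)) \<and> diff_upto n S f')"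

lemma diff_upto_SucI:
  assumes "\<And>x. x \<in> S \<Longrightarrow> (f has_real_derivative f' x) (at x within S)" and "diff_upto n S f'"
  shows "diff_upto (Suc n) S f"
  using assms by auto

lemma diff_upto_SucE:
  assumes "diff_upto (Suc n) S f"
  obtains f' where "\<And>x. x \<in> S \<Longrightarrow> (f has_real_derivative f' x) (at x within S)"
    and "diff_upto n S f'"
  using assms by auto

declare diff_upto.simps(2) [simp del]

lemma diff_upto_cong:
  assumes "\<And>x. x \<in> S \<Longrightarrow> f x = g x" and "diff_upto n S f"
  shows "diff_upto n S g"
proof (cases n)
  case (Suc m)
  from assms(2)[unfolded Suc] obtain f' where f': "\<And>x. x \<in> S \<Longrightarrow> (f has_real_derivative f' x) (at x within S)"
    and m: "diff_upto m S f'"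
    by (metis diff_upto_SucE)
  have "(g has_real_derivative f' x) (at x within S)" if "x \<in> S" for x
    using f'[OF that] assms(1) that by (rule_tac has_field_derivative_transform_within[of f _ _ _ 1]) auto
  with m show ?thesis
    unfolding Suc by (intro diff_upto_SucI)
qed simp

text \<open>Lowers the order by one. The product and chain rules need this because an
  undifferentiated function reappears next to a derivative that has lost one order.\<close>

lemma diff_upto_Suc_imp: "diff_upto (Suc n) S f \<Longrightarrow> diff_upto n S f"
proof (induction n arbitrary: f)
  case (Suc n)
  then show ?case by (metis diff_upto.simps(2))
qed simp

lemma diff_upto_subset: "diff_upto n S f \<Longrightarrow> T \<subseteq> S \<Longrightarrow> diff_upto n T f"
proof (induction n arbitrary: f)
  case (Suc n)
  obtain f' where "\<And>x. x \<in> S \<Longrightarrow> (f has_real_derivative f' x) (at x within S)"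
    and "diff_upto n S f'"
    using Suc.prems by (metis diff_upto_SucE)
  with Suc show ?case
    by (blast intro: diff_upto_SucI DERIV_subset)
qed simp

lemma diff_upto_const: "diff_upto n S (\<lambda>x. c)"
  by (induction n arbitrary: c) (auto intro!: diff_upto_SucI[of _ _ "\<lambda>_. 0"])

lemma diff_upto_ident: "diff_upto n S (\<lambda>x. x)"
  by (cases n) (auto intro!: diff_upto_SucI[of _ _ "\<lambda>_. 1"] diff_upto_const)

lemma diff_upto_add:
  "diff_upto n S f \<Longrightarrow> diff_upto n S g \<Longrightarrow> diff_upto n S (\<lambda>x. f x + g x)"
proof (induction n arbitrary: f g)
  case (Suc n)
  obtain f' g' where d: "\<And>x. x \<in> S \<Longrightarrow> (f has_real_derivative f' x) (at x within S)"
    "\<And>x. x \<in> S \<Longrightarrow> (g has_real_derivative g' x) (at x within S)"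
    "diff_upto n S f'" "diff_upto n S g'"
    using Suc.prems by (metis diff_upto_SucE)
  show ?case
  proof (rule diff_upto_SucI)
    show "((\<lambda>x. f x + g x) has_real_derivative f' x + g' x) (at x within S)" if "x \<in> S" for x
      using d(1,2)[OF that] by (rule DERIV_add)
    show "diff_upto n S (\<lambda>x. f' x + g' x)"
      using d(3,4) by (rule Suc.IH)
  qed
qed simp

lemma diff_upto_mult:
  "diff_upto n S f \<Longrightarrow> diff_upto n S g \<Longrightarrow> diff_upto n S (\<lambda>x. f x * g x)"
proof (induction n arbitrary: f g)
  case (Suc n)
  obtain f' g' where d: "\<And>x. x \<in> S \<Longrightarrow> (f has_real_derivative f' x) (at x within S)"
    "\<And>x. x \<in> S \<Longrightarrow> (g has_real_derivative g' x) (at x within S)"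
    "diff_upto n S f'" "diff_upto n S g'"
    using Suc.prems by (metis diff_upto_SucE)
  show ?case
  proof (rule diff_upto_SucI)
    show "((\<lambda>x. f x * g x) has_real_derivative f' x * g x + g' x * f x) (at x within S)"
      if "x \<in> S" for x
      using d(1,2)[OF that] by (rule DERIV_mult)
    show "diff_upto n S (\<lambda>x. f' x * g x + g' x * f x)"
      by (rule diff_upto_add[OF Suc.IH[OF d(3) diff_upto_Suc_imp[OF Suc.prems(2)]]
            Suc.IH[OF d(4) diff_upto_Suc_imp[OF Suc.prems(1)]]])
  qed
qed simp

lemma diff_upto_cmult: "diff_upto n S f \<Longrightarrow> diff_upto n S (\<lambda>x. c * f x)"
  by (rule diff_upto_mult[OF diff_upto_const])

lemma diff_upto_diff:
  assumes "diff_upto n S f" "diff_upto n S g"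
  shows "diff_upto n S (\<lambda>x. f x - g x)"
  using diff_upto_add[OF assms(1) diff_upto_cmult[OF assms(2), of "-1"]] by simp

text \<open>The derivative is \<open>f' (g x) * g' x\<close>. The induction hypothesis, with
  \<open>g\<close> taken one order lower, handles the first factor, which is why \<open>f\<close> is
  arbitrary in the induction.\<close>

lemma diff_upto_compose:
  "diff_upto n T f \<Longrightarrow> diff_upto n S g \<Longrightarrow> g ` S \<subseteq> T \<Longrightarrow> diff_upto n S (\<lambda>x. f (g x))"
proof (induction n arbitrary: f g)
  case (Suc n)
  obtain f' g' where d: "\<And>x. x \<in> T \<Longrightarrow> (f has_real_derivative f' x) (at x within T)"
    "\<And>x. x \<in> S \<Longrightarrow> (g has_real_derivative g' x) (at x within S)"
    "diff_upto n T f'" "diff_upto n S g'"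
    using Suc.prems by (metis diff_upto_SucE)
  show ?case
  proof (rule diff_upto_SucI)
    show "((\<lambda>x. f (g x)) has_real_derivative f' (g x) * g' x) (at x within S)" if "x \<in> S" for x
    proof -
      have "(f has_real_derivative f' (g x)) (at (g x) within g ` S)"
        using d(1) Suc.prems(3) that by (auto intro: DERIV_subset)
      from DERIV_image_chain[OF this d(2)[OF that]] show ?thesis
        by (simp add: o_def)
    qed
    show "diff_upto n S (\<lambda>x. f' (g x) * g' x)"
      by (rule diff_upto_mult[OF Suc.IH[OF d(3) diff_upto_Suc_imp[OF Suc.prems(2)] Suc.prems(3)] d(4)])
  qed
qed simp

text \<open>The derivative of \<open>1 / f\<close> is a product of \<open>f'\<close> with two copies
  of \<open>1 / f\<close> itself, and the latter already has order \<open>n\<close> by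
  induction.\<close>

lemma diff_upto_inverse:
  "diff_upto n S f \<Longrightarrow> (\<And>x. x \<in> S \<Longrightarrow> f x \<noteq> 0) \<Longrightarrow> diff_upto n S (\<lambda>x. inverse (f x))"
proof (induction n arbitrary: f)
  case (Suc n)
  obtain f' where d: "\<And>x. x \<in> S \<Longrightarrow> (f has_real_derivative f' x) (at x within S)" "diff_upto n S f'"
    using Suc.prems by (metis diff_upto_SucE)
  show ?case
  proof (rule diff_upto_SucI)
    show "((\<lambda>x. inverse (f x)) has_real_derivative -1 * (f' x * (inverse (f x) * inverse (f x)))) (at x within S)"
      if "x \<in> S" for x
      using DERIV_inverse_fun[OF d(1)] that Suc.prems(2) by (simp add: power2_eq_square)
    have inv: "diff_upto n S (\<lambda>x. inverse (f x))"
      by (rule Suc.IH[OF diff_upto_Suc_imp[OF Suc.prems(1)] Suc.prems(2)])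
    show "diff_upto n S (\<lambda>x. -1 * (f' x * (inverse (f x) * inverse (f x))))"
      by (rule diff_upto_cmult[OF diff_upto_mult[OF d(2) diff_upto_mult[OF inv inv]]])
  qed
qed simp

section \<open>Smoothness as differentiability of every finite order\<close>

lemma smooth_on_imp_diff_upto:
  assumes "smooth_on S f"
  shows "diff_upto n S f"
proof -
  obtain D where D: "D 0 = f" "\<And>k x. x \<in> S \<Longrightarrow> (D k has_real_derivative D (Suc k) x) (at x within S)"
    using assms by (auto simp: smooth_on_def)
  have "diff_upto n S (D k)" for k
    using D(2) by (induction n arbitrary: k) (auto intro!: diff_upto_SucI)
  then show ?thesis
    using D(1) by metis
qed

text \<open>Every point of a nondegenerate interval, endpoints included, is a limit point of it, so
  even one-sided derivatives are determined.\<close>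

lemma has_real_derivative_unique_Icc:
  fixes a b :: real
  assumes "a < b" "x \<in> {a..b}" "(f has_real_derivative d) (at x within {a..b})"
    "(f has_real_derivative e) (at x within {a..b})"
  shows "d = e"
proof -
  have "at x within {a..b} \<noteq> bot"
    using assms(1,2)
    by (cases "x = a \<or> x = b")
      (auto simp: at_within_Icc_at_right at_within_Icc_at_left at_within_Icc_at)
  then show ?thesis
    using assms(3,4) by (rule_tac has_field_derivative_unique)
qed

text \<open>Each order \<open>n\<close> comes with its own chain of derivatives, whereas smoothness
  asks for one infinite sequence. Uniqueness of derivatives makes all chains agree on the interval,
  so iterating a single choice of derivative \<open>ds\<close> gives the sequence.\<close>

lemma diff_upto_imp_smooth_on:
  fixes a b :: real
  assumes "a < b" and "\<And>n. diff_upto n {a..b} f"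
  shows "smooth_on {a..b} f"
proof -
  let ?S = "{a..b}"
  define ds :: "(real \<Rightarrow> real) \<Rightarrow> real \<Rightarrow> real"
    where "ds f x = (SOME d. (f has_real_derivative d) (at x within ?S))" for f x
  have ds: "\<And>x. x \<in> ?S \<Longrightarrow> (f has_real_derivative ds f x) (at x within ?S)" "diff_upto n ?S (ds f)"
    if f: "\<And>n. diff_upto n ?S f" for f n
  proof -
    show der: "(f has_real_derivative ds f x) (at x within ?S)" if "x \<in> ?S" for x
      using f[of 1] that unfolding ds_def by (auto elim!: diff_upto_SucE intro: someI)
    obtain f' where f': "\<And>x. x \<in> ?S \<Longrightarrow> (f has_real_derivative f' x) (at x within ?S)"
      and n: "diff_upto n ?S f'"
      using f[of "Suc n"] by (metis diff_upto_SucE)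
    have "f' x = ds f x" if "x \<in> ?S" for x
      using has_real_derivative_unique_Icc[OF assms(1) that f' der] that by auto
    then show "diff_upto n ?S (ds f)"
      using n by (rule diff_upto_cong)
  qed
  have all: "diff_upto n ?S ((ds ^^ k) f)" for n k
    by (induction k arbitrary: n) (use assms(2) ds in auto)
  show ?thesis
    unfolding smooth_on_def
    using ds(1)[OF all] by (intro exI[of _ "\<lambda>k. (ds ^^ k) f"]) auto
qed

lemma smooth_on_Icc_iff:
  "a < b \<Longrightarrow> smooth_on {a..b} f \<longleftrightarrow> (\<forall>n. diff_upto n {a..b} f)"
  using diff_upto_imp_smooth_on smooth_on_imp_diff_upto by blast

text \<open>Bootstrapping: \<open>h' = 1 / f' (h)\<close>, so order \<open>n\<close> for
  \<open>h\<close> gives order \<open>n\<close> for \<open>h'\<close> and hence order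
  \<open>n + 1\<close> for \<open>h\<close>.\<close>

lemma diff_upto_inverse_function:
  assumes f: "\<And>x. (f has_real_derivative f' x) (at x)" and pos: "\<And>x. f' x > 0"
    and n: "\<And>n. diff_upto n UNIV f'"
    and inv: "\<And>y. f (h y) = y"
  shows "diff_upto n UNIV h"
proof (induction n)
  case (Suc n)
  have mono: "x < y \<Longrightarrow> f x < f y" for x y
    using DERIV_pos_imp_increasing[of x y f] f pos by blast
  \<comment> \<open>The rule for the derivative of an inverse function presupposes continuity.
    Strict monotonicity makes the right inverse \<open>h\<close> also a left inverse, and an inverse
    of a continuous function is continuous.\<close>
  have "isCont h y" for y
  proof -
    let ?x = "h y"
    have hf: "h (f x) = x" for x
      by (metis inv mono linorder_neqE_linordered_idom order_less_irrefl)
    have "isCont h (f ?x)"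
      by (rule isCont_inverse_function[where d=1]) (auto simp: hf intro: DERIV_isCont[OF f])
    then show ?thesis by (simp add: inv)
  qed
  then have "(h has_real_derivative inverse (f' (h y))) (at y)" for y
   
    using pos[of "h y"] by (intro DERIV_inverse_function[OF f, where a = "y - 1" and b = "y + 1"]) (auto simp: inv)
  moreover have "diff_upto n UNIV (\<lambda>y. inverse (f' (h y)))"
    by (rule diff_upto_inverse[OF diff_upto_compose[OF n Suc.IH]])
      (simp_all add: order_less_imp_not_eq2[OF pos])
  ultimately show ?case
    by (intro diff_upto_SucI)
qed simp

section \<open>A flat function\<close>

text \<open>Only \<open>flat 0\<close>, the classical function \<open>exp (- 1 / x)\<close> extended
  by zero, is wanted as a building block. The extra power makes the family closed under
  differentiation up to linear combinations.\<close>

definition flat :: "nat \<Rightarrow> real \<Rightarrow> real" where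
  "flat n x = (if x \<le> 0 then 0 else (1 / x) ^ n * exp (- (1 / x)))"

lemma flat_nonpos: "x \<le> 0 \<Longrightarrow> flat n x = 0"
  by (simp add: flat_def)

lemma flat_pos: "0 < x \<Longrightarrow> 0 < flat n x"
  by (simp add: flat_def)

lemma flat_nonneg: "0 \<le> flat n x"
  by (simp add: flat_def)

lemma flat_0_le_1: "flat 0 x \<le> 1"
  by (simp add: flat_def)

text \<open>\<open>flat 2\<close> is the derivative of \<open>flat 0\<close>; this bound limits the
  slope of the bumps built later. It is the estimate \<open>y / 2 \<le> exp (y / 2)\<close>,
  squared, at \<open>y = 1 / x\<close>.\<close>

lemma flat_2_le_4: "flat 2 x \<le> 4"
proof (cases "x \<le> 0")
  case False
  define y where "y = 1 / x"
  have y: "0 < y" using False by (simp add: y_def)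
  have "y / 2 \<le> exp (y / 2)"
    using exp_ge_add_one_self[of "y / 2"] by linarith
  then have "(y / 2)\<^sup>2 \<le> (exp (y / 2))\<^sup>2"
    using y by (intro power_mono) auto
  also have "\<dots> = exp y"
    by (simp add: exp_double[symmetric])
  finally have "y\<^sup>2 \<le> 4 * exp y"
    by (simp add: power_divide)
  then show ?thesis
    using False by (simp add: flat_def y_def[symmetric] exp_minus field_simps)
qed (simp add: flat_def)

lemma has_real_derivative_flat:
  "(flat n has_real_derivative flat (n + 2) x - n * flat (n + 1) x) (at x)"
proof -
  consider "x < 0" | "x = 0" | "0 < x" by linarith
  then show ?thesis
  proof cases
    case 1
    then have "((\<lambda>x. 0) has_real_derivative flat (n + 2) x - n * flat (n + 1) x) (at x)"
      by (simp add: flat_def)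
    then show ?thesis
      by (rule has_field_derivative_transform_within_open[of _ _ _ "{..<0}"])
        (use 1 in \<open>auto simp: flat_def\<close>)
  next
    case 2
    \<comment> \<open>At zero the difference quotient from the right is
      \<open>(1 / x) ^ (n + 1) * exp (- (1 / x))\<close>; it tends to zero because the exponential
      outgrows every power.\<close>
    have "((\<lambda>y::real. y ^ (n + 1) / exp y) \<longlongrightarrow> 0) at_top"
      by (rule tendsto_power_div_exp_0)
    then have "((\<lambda>x. inverse x ^ (n + 1) / exp (inverse x)) \<longlongrightarrow> 0) (at_right (0::real))"
      by (rule filterlim_compose[OF _ filterlim_inverse_at_top_right])
    then have r: "((\<lambda>y. flat n y / y) \<longlongrightarrow> 0) (at_right 0)"
      by (rule Lim_transform_eventually)
        (auto simp: flat_def eventually_at_filter exp_minus field_simps)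
    have l: "((\<lambda>y. flat n y / y) \<longlongrightarrow> 0) (at_left 0)"
      by (rule tendsto_eventually) (auto simp: flat_def eventually_at_filter)
    from l r show ?thesis
      unfolding 2 by (simp add: has_field_derivative_iff filterlim_at_split flat_nonpos)
  next
    case 3
    have "((\<lambda>x. (1 / x) ^ n * exp (- (1 / x))) has_real_derivative flat (n + 2) x - n * flat (n + 1) x) (at x)"
      using 3 by (auto intro!: derivative_eq_intros simp: flat_def)
        (cases n; simp add: field_simps power2_eq_square)
    then show ?thesis
      by (rule has_field_derivative_transform_within_open[of _ _ _ "{0<..}"])
        (use 3 in \<open>auto simp: flat_def\<close>)
  qed
qed

lemma diff_upto_flat: "diff_upto k S (flat n)"
proof -
  have "diff_upto k UNIV (flat n)"
  proof (induction k arbitrary: n)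
    case (Suc k)
    show ?case
      by (rule diff_upto_SucI[OF has_real_derivative_flat])
        (rule diff_upto_diff[OF Suc.IH diff_upto_cmult[OF Suc.IH]])
  qed simp
  then show ?thesis
    by (rule diff_upto_subset) simp
qed

section \<open>The group of diffeomorphisms\<close>

lemma carrier_Diff_infty:
  "f \<in> carrier Diff_infty \<longleftrightarrow> f \<in> Bij {0..1} \<and> strict_mono_on {0..1} f \<and>
    smooth_on {0..1} f \<and> smooth_on {0..1} (inv_into {0..1} f)"
  by (simp add: Diff_infty_def)

lemma smooth_on_compose_Icc:
  fixes a b c d :: real
  assumes "a < b" "c < d" "smooth_on {c..d} f" "smooth_on {a..b} g" "g ` {a..b} \<subseteq> {c..d}"
  shows "smooth_on {a..b} (\<lambda>x. f (g x))"
  using assms diff_upto_compose[of _ "{c..d}" f "{a..b}" g] by (simp add: smooth_on_Icc_iff)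

lemma smooth_on_cong_Icc:
  fixes a b :: real
  assumes "a < b" "\<And>x. x \<in> {a..b} \<Longrightarrow> f x = g x" "smooth_on {a..b} f"
  shows "smooth_on {a..b} g"
  using assms(3) diff_upto_cong[of "{a..b}" f g] assms(2)
  unfolding smooth_on_Icc_iff[OF assms(1)] by blast

lemma inv_into_compose:
  assumes "f \<in> Bij S" "g \<in> Bij S" "y \<in> S"
  shows "inv_into S (compose S f g) y = inv_into S g (inv_into S f y)"
proof (rule inv_into_f_eq)
  show "inj_on (compose S f g) S"
    using compose_Bij[OF assms(1,2)] by (simp add: Bij_def bij_betw_def)
  show mem: "inv_into S g (inv_into S f y) \<in> S"
    using assms by (intro Bij_inv_into_mem)
  show "compose S f g (inv_into S g (inv_into S f y)) = y"
    using assms mem Bij_inv_into_mem[OF assms(1,3)]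
    by (auto simp: compose_def Bij_def bij_betw_inv_into_right)
qed

lemma strict_mono_on_inv_into:
  fixes f :: "'a::linorder \<Rightarrow> 'b::linorder"
  assumes "strict_mono_on S f" "f ` S = T"
  shows "strict_mono_on T (inv_into S f)"
proof (rule strict_mono_onI)
  fix x y assume "x \<in> T" "y \<in> T" "x < y"
  then show "inv_into S f x < inv_into S f y"
    using assms strict_mono_on_leD[OF assms(1), of "inv_into S f y" "inv_into S f x"]
    by (metis f_inv_into_f inv_into_into leD leI)
qed

text \<open>\<open>Diff_infty\<close> only shrinks the carrier of \<open>BijGroup\<close>, so its
  group laws follow from closure. Smoothness of inverses is part of membership, which makes the
  condition symmetric under inversion.\<close>

lemma subgroup_Diff_infty: "subgroup (carrier Diff_infty) (BijGroup {0..1})"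
proof -
  let ?S = "{0..1::real}"
  interpret group "BijGroup ?S" by (rule group_BijGroup)
  show ?thesis
  proof (rule subgroup.intro)
    show "carrier Diff_infty \<subseteq> carrier (BijGroup ?S)"
      by (auto simp: carrier_Diff_infty BijGroup_def)
    have "smooth_on ?S (\<lambda>x. x)"
      by (simp add: smooth_on_Icc_iff diff_upto_ident)
    moreover have "inv_into ?S (\<lambda>x\<in>?S. x) x = x" if "x \<in> ?S" for x
      using that by (intro inv_into_f_eq) (auto simp: inj_on_def)
    ultimately show "\<one>\<^bsub>BijGroup ?S\<^esub> \<in> carrier Diff_infty"
      by (auto simp: carrier_Diff_infty BijGroup_def id_Bij strict_mono_on_def
          intro: smooth_on_cong_Icc[of 0 1 "\<lambda>x. x"])
  next
    fix f g assume f: "f \<in> carrier Diff_infty" and g: "g \<in> carrier Diff_infty"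
    then have B: "f \<in> Bij ?S" "g \<in> Bij ?S"
      by (auto simp: carrier_Diff_infty)
    then have im: "g ` ?S = ?S" "inv_into ?S f ` ?S = ?S"
      using bij_betw_inv_into[of f ?S ?S] by (simp_all add: Bij_def bij_betw_def)
    have sm: "smooth_on ?S f" "smooth_on ?S g" "smooth_on ?S (inv_into ?S f)" "smooth_on ?S (inv_into ?S g)"
      using f g by (simp_all add: carrier_Diff_infty)
    have "smooth_on ?S (\<lambda>x. f (g x))"
      using sm(1,2) equalityD1[OF im(1)] by (rule smooth_on_compose_Icc[rotated 2]) simp_all
    then have "smooth_on ?S (compose ?S f g)"
      by (rule smooth_on_cong_Icc[rotated 2]) (simp_all add: compose_def)
    moreover have "smooth_on ?S (\<lambda>x. inv_into ?S g (inv_into ?S f x))"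
      using sm(4,3) equalityD1[OF im(2)] by (rule smooth_on_compose_Icc[rotated 2]) simp_all
    then have "smooth_on ?S (inv_into ?S (compose ?S f g))"
      by (rule smooth_on_cong_Icc[rotated 2]) (simp_all add: inv_into_compose[OF B])
    moreover have "strict_mono_on ?S (compose ?S f g)"
      using f g Bij_imp_funcset[OF B(2)]
      by (auto simp: carrier_Diff_infty strict_mono_on_def compose_def Pi_iff)
    ultimately show "f \<otimes>\<^bsub>BijGroup ?S\<^esub> g \<in> carrier Diff_infty"
      using B by (simp add: carrier_Diff_infty BijGroup_def compose_Bij)
  next
    fix f assume f: "f \<in> carrier Diff_infty"
    let ?h = "\<lambda>x\<in>?S. inv_into ?S f x"
    have B: "f \<in> Bij ?S" using f by (simp add: carrier_Diff_infty)
    then have bij: "bij_betw f ?S ?S" by (simp add: Bij_def)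
    have sm: "smooth_on ?S f" "smooth_on ?S (inv_into ?S f)"
      using f by (simp_all add: carrier_Diff_infty)
    have "smooth_on ?S ?h"
      using sm(2) by (rule smooth_on_cong_Icc[rotated 2]) simp_all
    \<comment> \<open>Inverting the inverse returns \<open>f\<close> on the interval, so smoothness
      of \<open>f\<close> is the second smoothness condition for \<open>?h\<close>.\<close>
    moreover have inv: "f x = inv_into ?S ?h x" if "x \<in> ?S" for x
    proof (rule inv_into_f_eq[symmetric])
      show "inj_on ?h ?S"
        using restrict_inv_into_Bij[OF B] by (simp add: Bij_def bij_betw_def)
      show "f x \<in> ?S" using Bij_imp_funcset[OF B] that by auto
      then show "?h (f x) = x"
        using bij that by (simp add: bij_betw_inv_into_left)
    qed
    have "smooth_on ?S (inv_into ?S ?h)"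
      by (rule smooth_on_cong_Icc[OF zero_less_one inv sm(1)])
    moreover have "strict_mono_on ?S ?h"
    proof -
      have "strict_mono_on ?S (inv_into ?S f)"
        using f bij by (intro strict_mono_on_inv_into) (simp_all add: carrier_Diff_infty bij_betw_def)
      then show ?thesis by (simp add: strict_mono_on_def)
    qed
    ultimately show "inv\<^bsub>BijGroup ?S\<^esub> f \<in> carrier Diff_infty"
      using B by (simp add: carrier_Diff_infty inv_BijGroup restrict_inv_into_Bij)
  qed
qed

section \<open>Pointwise evaluation of the group operations\<close>

lemma group_Diff_infty: "group Diff_infty"
  using group.subgroup_imp_group[OF group_BijGroup subgroup_Diff_infty]
  by (simp add: Diff_infty_def)

lemma Diff_infty_in_Icc:
  "f \<in> carrier Diff_infty \<Longrightarrow> t \<in> {0..1} \<Longrightarrow> f t \<in> {0..1}"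
  unfolding carrier_Diff_infty using Bij_imp_funcset by blast

lemma Diff_infty_mult:
  assumes "f \<in> carrier Diff_infty" "g \<in> carrier Diff_infty" "t \<in> {0..1}"
  shows "(f \<otimes>\<^bsub>Diff_infty\<^esub> g) t = f (g t)"
  using assms by (simp add: carrier_Diff_infty) (simp add: Diff_infty_def BijGroup_def compose_def)

lemma Diff_infty_one: "t \<in> {0..1} \<Longrightarrow> \<one>\<^bsub>Diff_infty\<^esub> t = t"
  by (simp add: Diff_infty_def BijGroup_def)

lemma Diff_infty_eqI:
  assumes "f \<in> carrier Diff_infty" "g \<in> carrier Diff_infty"
    and "\<And>t. t \<in> {0..1} \<Longrightarrow> f t = g t"
  shows "f = g"
  using assms unfolding carrier_Diff_infty Bij_def by (auto intro: extensionalityI)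

lemma Diff_infty_less_iff:
  assumes "f \<in> carrier Diff_infty" "s \<in> {0..1}" "t \<in> {0..1}"
  shows "f s < f t \<longleftrightarrow> s < t"
  using assms strict_mono_on_less unfolding carrier_Diff_infty by blast

lemma Diff_infty_le_iff:
  assumes "f \<in> carrier Diff_infty" "s \<in> {0..1}" "t \<in> {0..1}"
  shows "f s \<le> f t \<longleftrightarrow> s \<le> t"
  using Diff_infty_less_iff[OF assms(1,3,2)] by (simp add: not_less[symmetric])

lemma Diff_infty_inv:
  assumes "f \<in> carrier Diff_infty" "t \<in> {0..1}"
  shows "(inv\<^bsub>Diff_infty\<^esub> f) (f t) = t" "f ((inv\<^bsub>Diff_infty\<^esub> f) t) = t"
proof -
  interpret group Diff_infty by (rule group_Diff_infty)
  show "(inv\<^bsub>Diff_infty\<^esub> f) (f t) = t"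
    using Diff_infty_mult[of "inv\<^bsub>Diff_infty\<^esub> f" f t] assms by (simp add: Diff_infty_one)
  show "f ((inv\<^bsub>Diff_infty\<^esub> f) t) = t"
    using Diff_infty_mult[of f "inv\<^bsub>Diff_infty\<^esub> f" t] assms by (simp add: Diff_infty_one)
qed

lemma Diff_infty_pow:
  assumes "f \<in> carrier Diff_infty" "t \<in> {0..1}"
  shows "(f [^]\<^bsub>Diff_infty\<^esub> (n::nat)) t = (f ^^ n) t"
  using assms(2)
proof (induction n arbitrary: t)
  case 0
  then show ?case by (simp add: Diff_infty_one)
next
  case (Suc n)
  interpret group Diff_infty by (rule group_Diff_infty)
  show ?case
    using Suc assms(1)
    by (simp add: Diff_infty_mult Diff_infty_in_Icc funpow_swap1 del: atLeastAtMost_iff)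
qed

text \<open>Starting from a function on the whole line allows ordinary two-sided derivatives when
  inverting. Fixing 0 and 1 together with monotonicity confines \<open>f\<close> and its inverse to
  the interval.\<close>

lemma restrict_in_Diff_infty:
  assumes f: "\<And>x. (f has_real_derivative f' x) (at x)" and pos: "\<And>x. f' x > 0"
    and smooth: "\<And>n. diff_upto n UNIV f'"
    and "surj f" and f01: "f 0 = 0" "f 1 = 1"
  shows "restrict f {0..1} \<in> carrier Diff_infty"
proof -
  let ?S = "{0..1::real}"
  obtain h where h: "f (h y) = y" for y
    using \<open>surj f\<close> by (metis surjD)
  have mono: "strict_mono f"
    using DERIV_pos_imp_increasing[of _ _ f] f pos by (intro strict_monoI) blast
  have hS: "h y \<in> ?S" if "y \<in> ?S" for y
    using strict_mono_less_eq[OF mono, of 0 "h y"] strict_mono_less_eq[OF mono, of "h y" 1]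
      that by (simp add: h f01)
  have fS: "f x \<in> ?S" if "x \<in> ?S" for x
    using strict_mono_less_eq[OF mono, of 0 x] strict_mono_less_eq[OF mono, of x 1]
      that by (simp add: f01)
  have inj: "inj_on (restrict f ?S) ?S"
    using strict_mono_eq[OF mono] by (auto simp: inj_on_def)
  have "y \<in> f ` ?S" if "y \<in> ?S" for y
    using hS[OF that] h[of y] by (metis imageI)
  then have "restrict f ?S ` ?S = ?S"
    using fS by (auto simp del: atLeastAtMost_iff)
  then have "restrict f ?S \<in> Bij ?S"
    using inj by (simp add: Bij_def bij_betw_def)
  moreover have "strict_mono_on ?S (restrict f ?S)"
    using mono by (auto simp: strict_mono_on_def strict_mono_def)
  moreover have "diff_upto n UNIV f" for n
    using f smooth by (intro diff_upto_Suc_imp[OF diff_upto_SucI[of _ f f']]) auto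
  then have "smooth_on ?S f"
    by (intro diff_upto_imp_smooth_on) (auto intro: diff_upto_subset[of _ UNIV])
  then have "smooth_on ?S (restrict f ?S)"
    by (rule smooth_on_cong_Icc[rotated 2]) simp_all
  moreover have inv: "h y = inv_into ?S (restrict f ?S) y" if "y \<in> ?S" for y
    using hS[OF that] that by (intro inv_into_f_eq[OF inj, symmetric]) (auto simp: h)
  have h_smooth: "smooth_on ?S h"
    using diff_upto_inverse_function[OF f pos smooth h]
    by (intro diff_upto_imp_smooth_on) (auto intro: diff_upto_subset[of _ UNIV])
  have "smooth_on ?S (inv_into ?S (restrict f ?S))"
    by (rule smooth_on_cong_Icc[OF zero_less_one inv h_smooth])
  ultimately show ?thesis
    by (simp add: carrier_Diff_infty)
qed

section \<open>Groups generated by images of words\<close>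

definition word_inv :: "'a word \<Rightarrow> 'a word" where
  "word_inv u = rev (map (\<lambda>(x, b). (x, \<not> b)) u)"

lemma word_inv_append: "word_inv (u @ v) = word_inv v @ word_inv u"
  by (simp add: word_inv_def)

lemma word_inv_word_inv: "word_inv (word_inv u) = u"
  by (induction u) (auto simp: word_inv_def)

lemma pres_eq_word_inv_left: "pres_eq R (word_inv u @ u) []"
  unfolding word_inv_def by (rule word_inverse)

lemma pres_eq_word_inv_right: "pres_eq R (u @ word_inv u) []"
  using pres_eq_word_inv_left[of R "word_inv u"] by (simp add: word_inv_word_inv)

text \<open>The homomorphism from the free group induced by \<open>g\<close>, computed on words that
  need not be reduced.\<close>

definition word_eval :: "('b, 'c) monoid_scheme \<Rightarrow> ('a \<Rightarrow> 'b) \<Rightarrow> 'a word \<Rightarrow> 'b" where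
  "word_eval G g w =
    foldr (\<lambda>(x, b) r. (if b then g x else inv\<^bsub>G\<^esub> (g x)) \<otimes>\<^bsub>G\<^esub> r) w \<one>\<^bsub>G\<^esub>"

lemma word_eval_Nil [simp]: "word_eval G g [] = \<one>\<^bsub>G\<^esub>"
  by (simp add: word_eval_def)

lemma word_eval_Cons [simp]:
  "word_eval G g ((x, b) # w) = (if b then g x else inv\<^bsub>G\<^esub> (g x)) \<otimes>\<^bsub>G\<^esub> word_eval G g w"
  by (simp add: word_eval_def)

context group
begin

lemma word_eval_closed [simp, intro]:
  "range g \<subseteq> carrier G \<Longrightarrow> word_eval G g w \<in> carrier G"
  by (induction w) (auto simp: image_subset_iff)

lemma word_eval_append:
  assumes "range g \<subseteq> carrier G"
  shows "word_eval G g (u @ v) = word_eval G g u \<otimes> word_eval G g v"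
proof (induction u)
  case (Cons a u)
  have "g x \<in> carrier G" for x using assms by auto
  with Cons assms show ?case
    by (cases a) (simp add: m_assoc)
qed (simp add: assms)

lemma word_eval_pres_eq:
  assumes g: "range g \<subseteq> carrier G"
    and R: "\<And>l r. (l, r) \<in> R \<Longrightarrow> word_eval G g l = word_eval G g r"
  shows "pres_eq R u v \<Longrightarrow> word_eval G g u = word_eval G g v"
proof (induction rule: pres_eq.induct)
  case (cancel u x b v)
  have "g x \<in> carrier G" using g by auto
  then have "g x \<otimes> (inv (g x) \<otimes> y) = y" "inv (g x) \<otimes> (g x \<otimes> y) = y" if "y \<in> carrier G" for y
    using that by (simp_all add: m_assoc[symmetric])
  with g show ?case
    by (simp add: word_eval_append)
qed (simp_all add: word_eval_append[OF g] R)

text \<open>If the relations hold among the \<open>g x\<close>, evaluation descends to the presented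
  group; if only trivial words evaluate to the unit, it is injective. The subgroup is its
  image.\<close>

lemma presented_group_iso_subgroup:
  assumes g: "range g \<subseteq> carrier G"
    and R: "\<And>l r. (l, r) \<in> R \<Longrightarrow> word_eval G g l = word_eval G g r"
    and ker: "\<And>u. word_eval G g u = \<one> \<Longrightarrow> pres_eq R u []"
  shows "\<exists>H. subgroup H G \<and> presented_group R \<cong> G\<lparr>carrier := H\<rparr>"
proof -
  let ?P = "presented_group R"
  define cls where "cls u = {w. pres_eq R w u}" for u
  \<comment> \<open>Evaluates an arbitrary representative of the class; \<open>h_cls\<close> shows
    independence of the choice.\<close>
  define h where "h A = word_eval G g (SOME u. u \<in> A)" for A
  have h_cls: "h (cls u) = word_eval G g u" for u
  proof -
    have "(SOME v. v \<in> cls u) \<in> cls u"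
      by (rule someI[of _ u]) (simp add: cls_def pres_eq.refl)
    then show ?thesis
      unfolding h_def using word_eval_pres_eq[OF g R] by (simp add: cls_def)
  qed
  have carr: "carrier ?P = range cls"
    by (auto simp: presented_group_carrier cls_def)
  have mult: "cls u \<otimes>\<^bsub>?P\<^esub> cls v = cls (u @ v)" for u v
    unfolding cls_def by (rule presented_group_mult)
  have hom: "h \<in> hom ?P G"
    using g by (auto simp: hom_def carr mult h_cls word_eval_append)
  interpret h: group_hom ?P G h
    using hom group_presented_group is_group by (simp add: group_hom_def group_hom_axioms_def)
  have "inj_on h (carrier ?P)"
  proof -
    have "A = \<one>\<^bsub>?P\<^esub>" if "A \<in> carrier ?P" "h A = \<one>" for A
    proof -
      obtain u where u: "A = cls u" using \<open>A \<in> carrier ?P\<close> carr by blast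
      then have "pres_eq R u []" using that(2) ker by (simp add: h_cls)
      then show ?thesis by (simp add: u cls_def presented_group_one pres_eq_class)
    qed
    then show ?thesis
      unfolding h.inj_iff_trivial_ker by (auto simp: kernel_def)
  qed
  then have "h \<in> iso ?P (G\<lparr>carrier := h ` carrier ?P\<rparr>)"
    using hom by (auto simp: iso_def bij_betw_def hom_def)
  then show ?thesis
    using h.img_is_subgroup by (auto simp: is_iso_def)
qed

end

section \<open>Words in Thompson's group\<close>

abbreviation thompson_eq :: "nat word \<Rightarrow> nat word \<Rightarrow> bool" where
  "thompson_eq \<equiv> pres_eq thompson_relations"

definition pos_word :: "nat list \<Rightarrow> nat word" where
  "pos_word w = map (\<lambda>i. (i, True)) w"

lemma pos_word_simps [simp]:
  "pos_word [] = []" "pos_word (i # w) = (i, True) # pos_word w"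
  "pos_word (v @ w) = pos_word v @ pos_word w"
  by (simp_all add: pos_word_def)

lemma pres_eq_in_context:
  "pres_eq R u v \<Longrightarrow> pres_eq R (p @ u @ q) (p @ v @ q)"
  by (intro pres_eq_append pres_eq.refl)

section \<open>Commutation rules for two letters and the fraction form of a word\<close>

lemma thompson_eq_rel:
  "i < j \<Longrightarrow> thompson_eq (u @ [(i, False), (j, True), (i, True)] @ v) (u @ [(j + 1, True)] @ v)"
  by (rule pres_eq.rel) (auto simp: thompson_relations_def)

lemma thompson_eq_pos_pos:
  assumes "i < j"
  shows "thompson_eq [(j, True), (i, True)] [(i, True), (j + 1, True)]"
proof -
  have "thompson_eq [(i, True), (i, False), (j, True), (i, True)] [(j, True), (i, True)]"
    using pres_eq.cancel[of thompson_relations "[]" i True "[(j, True), (i, True)]"] by simp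
  moreover have "thompson_eq [(i, True), (i, False), (j, True), (i, True)] [(i, True), (j + 1, True)]"
    using thompson_eq_rel[OF assms, of "[(i, True)]" "[]"] by simp
  ultimately show ?thesis
    by (blast intro: pres_eq.sym pres_eq.trans)
qed

lemma thompson_eq_neg_pos_less:
  assumes "i < j"
  shows "thompson_eq [(i, False), (j, True)] [(j + 1, True), (i, False)]"
proof -
  have "thompson_eq [(i, False), (j, True), (i, True), (i, False)] [(j + 1, True), (i, False)]"
    using thompson_eq_rel[OF assms, of "[]" "[(i, False)]"] by simp
  moreover have "thompson_eq [(i, False), (j, True), (i, True), (i, False)] [(i, False), (j, True)]"
    using pres_eq.cancel[of thompson_relations "[(i, False), (j, True)]" i True "[]"] by simp
  ultimately show ?thesis
    by (blast intro: pres_eq.sym pres_eq.trans)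
qed

text \<open>Multiply \<open>thompson_eq_pos_pos\<close> by the inverse of generator \<open>j\<close>
  on the left and of generator \<open>j + 1\<close> on the right, then cancel on both sides.\<close>

lemma thompson_eq_neg_pos_greater:
  assumes "i < j"
  shows "thompson_eq [(j, False), (i, True)] [(i, True), (j + 1, False)]"
proof -
  have a: "thompson_eq [(j, False), (j, True), (i, True), (j + 1, False)]
      [(j, False), (i, True), (j + 1, True), (j + 1, False)]"
    using pres_eq_in_context[OF thompson_eq_pos_pos[OF assms], of "[(j, False)]" "[(j + 1, False)]"]
    by simp
  have b: "thompson_eq [(j, False), (j, True), (i, True), (j + 1, False)]
      [(i, True), (j + 1, False)]"
    using pres_eq.cancel[of thompson_relations "[]" j False "[(i, True), (j + 1, False)]"] by simp
  have c: "thompson_eq [(j, False), (i, True), (j + 1, True), (j + 1, False)]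
      [(j, False), (i, True)]"
    using pres_eq.cancel[of thompson_relations "[(j, False), (i, True)]" "j + 1" True "[]"] by simp
  show ?thesis
    by (rule pres_eq.trans[OF pres_eq.sym[OF c] pres_eq.trans[OF pres_eq.sym[OF a] b]])
qed

text \<open>The inverse letter travels right through the positive letters. Each exchange may change
  its index, hence the generalisation over \<open>i\<close>, but it stays a single letter until it
  cancels or reaches the end.\<close>

lemma thompson_eq_neg_pos_word:
  "\<exists>P N. thompson_eq ((i, False) # pos_word w) (pos_word P @ word_inv (pos_word N))"
proof (induction w arbitrary: i)
  case Nil
  show ?case
    by (rule exI[of _ "[]"], rule exI[of _ "[i]"]) (simp add: word_inv_def pres_eq.refl)
next
  case (Cons a w)
  \<comment> \<open>Common treatment of both exchanges: the inverse letter passes \<open>a\<close>,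
    and the induction hypothesis continues with its new index \<open>i'\<close>.\<close>
  have shift: ?case if a': "thompson_eq [(i, False), (a, True)] [(a', True), (i', False)]" for a' i'
  proof -
    obtain P N where "thompson_eq ((i', False) # pos_word w) (pos_word P @ word_inv (pos_word N))"
      using Cons.IH by blast
    from pres_eq_in_context[OF this, of "[(a', True)]" "[]"]
    have "thompson_eq ((a', True) # (i', False) # pos_word w) (pos_word (a' # P) @ word_inv (pos_word N))"
      by simp
    moreover have "thompson_eq ((i, False) # pos_word (a # w)) ((a', True) # (i', False) # pos_word w)"
      using pres_eq_in_context[OF a', of "[]" "pos_word w"] by simp
    ultimately show ?thesis
      using pres_eq.trans by blast
  qed
  consider "i < a" | "a < i" | "a = i" by linarith
  then show ?case
  proof cases
    case 1
    then show ?thesis by (rule shift[OF thompson_eq_neg_pos_less])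
  next
    case 2
    then show ?thesis by (rule shift[OF thompson_eq_neg_pos_greater])
  next
    case 3
    then show ?thesis
      using pres_eq.cancel[of thompson_relations "[]" i False "pos_word w"]
      by (intro exI[of _ w] exI[of _ "[]"]) (simp add: word_inv_def)
  qed
qed

lemma thompson_eq_fraction:
  "\<exists>P N. thompson_eq u (pos_word P @ word_inv (pos_word N))"
proof (induction u)
  case Nil
  show ?case
    by (rule exI[of _ "[]"], rule exI[of _ "[]"]) (simp add: word_inv_def pres_eq.refl)
next
  case (Cons a u)
  obtain x b where a: "a = (x, b)" by fastforce
  obtain P N where "thompson_eq u (pos_word P @ word_inv (pos_word N))"
    using Cons.IH by blast
  from pres_eq_in_context[OF this, of "[(x, b)]" "[]"]
  have u: "thompson_eq (a # u) ((x, b) # pos_word P @ word_inv (pos_word N))"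
    by (simp add: a)
  show ?case
  proof (cases b)
    case True
    then show ?thesis
      using u by (intro exI[of _ "x # P"] exI[of _ N]) simp
  next
    case False
    obtain P' N' where "thompson_eq ((x, False) # pos_word P) (pos_word P' @ word_inv (pos_word N'))"
      using thompson_eq_neg_pos_word by blast
    from pres_eq_in_context[OF this, of "[]" "word_inv (pos_word N)"]
    have "thompson_eq ((x, b) # pos_word P @ word_inv (pos_word N))
        (pos_word P' @ word_inv (pos_word (N @ N')))"
      using False by (simp add: word_inv_append)
    then show ?thesis
      using u pres_eq.trans by blast
  qed
qed

text \<open>The first occurrence of \<open>m\<close> moves left past larger letters, raising each of
  them by one. The length equation supports the later induction on word length.\<close>

lemma thompson_eq_min_first:
  assumes "m \<in> set w" "\<And>j. j \<in> set w \<Longrightarrow> m \<le> j"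
  obtains w' where "length w = Suc (length w')" "thompson_eq (pos_word w) (pos_word (m # w'))"
proof -
  have "\<exists>w'. length w = Suc (length w') \<and> thompson_eq (pos_word w) (pos_word (m # w'))"
    using assms
  proof (induction w)
    case (Cons a w)
    show ?case
    proof (cases "a = m")
      case True
      then show ?thesis by (auto intro: pres_eq.refl)
    next
      case False
      then have "m < a" "m \<in> set w" using Cons.prems by (auto simp: order_less_le)
      with Cons obtain w' where w': "length w = Suc (length w')"
        "thompson_eq (pos_word w) (pos_word (m # w'))"
        by auto
      have "thompson_eq (pos_word (a # w)) (pos_word (a # m # w'))"
        using pres_eq_in_context[OF w'(2), of "[(a, True)]" "[]"] by simp
      moreover have "thompson_eq (pos_word (a # m # w')) (pos_word (m # (a + 1) # w'))"
        using pres_eq_in_context[OF thompson_eq_pos_pos[OF \<open>m < a\<close>], of "[]" "pos_word w'"] by simp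
      ultimately have "thompson_eq (pos_word (a # w)) (pos_word (m # (a + 1) # w'))"
        by (rule pres_eq.trans)
      then show ?thesis
        using w'(1) by (intro exI[of _ "(a + 1) # w'"]) simp
    qed
  qed simp
  then show thesis using that by blast
qed

section \<open>Faithfulness\<close>

text \<open>
  The points witnessing \<open>moved\<close> make the least index in a positive word visible in the
  diffeomorphism that the word represents.
\<close>

locale thompson_action =
  fixes X :: "nat \<Rightarrow> real \<Rightarrow> real"
  assumes X_closed: "X i \<in> carrier Diff_infty"
    and X_rel: "i < j \<Longrightarrow> X j \<otimes>\<^bsub>Diff_infty\<^esub> X i = X i \<otimes>\<^bsub>Diff_infty\<^esub> X (j + 1)"
    and X_le: "t \<in> {0..1} \<Longrightarrow> X i t \<le> t"
    and moved: "\<exists>t\<in>{0..1}. X m t \<noteq> t \<and> (\<forall>j>m. X j t = t)"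
begin

sublocale group Diff_infty
  by (rule group_Diff_infty)

lemma range_X: "range X \<subseteq> carrier Diff_infty"
  using X_closed by auto

lemma word_eval_thompson_eq:
  assumes "thompson_eq u v"
  shows "word_eval Diff_infty X u = word_eval Diff_infty X v"
proof (rule word_eval_pres_eq[OF range_X _ assms])
  fix l r assume "(l, r) \<in> thompson_relations"
  then obtain i j where "i < j" "l = [(i, False), (j, True), (i, True)]" "r = [(j + 1, True)]"
    by (auto simp: thompson_relations_def)
  moreover have "inv\<^bsub>Diff_infty\<^esub> X i \<otimes>\<^bsub>Diff_infty\<^esub> (X i \<otimes>\<^bsub>Diff_infty\<^esub> X (Suc j)) = X (Suc j)"
    using X_closed by (simp add: m_assoc[symmetric])
  ultimately show "word_eval Diff_infty X l = word_eval Diff_infty X r"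
    using X_closed X_rel[of i j] by simp
qed

lemma word_eval_X_closed: "word_eval Diff_infty X w \<in> carrier Diff_infty"
  using range_X by (rule word_eval_closed)

lemma word_eval_pos_Cons:
  "t \<in> {0..1} \<Longrightarrow> word_eval Diff_infty X (pos_word (i # w)) t =
    X i (word_eval Diff_infty X (pos_word w) t)"
  by (simp only: pos_word_simps word_eval_Cons if_True
      Diff_infty_mult[OF X_closed word_eval_X_closed])

lemma word_eval_pos_le:
  assumes t: "t \<in> {0..1}"
  shows "word_eval Diff_infty X (pos_word w) t \<le> t"
proof (induction w)
  case Nil
  show ?case using t by (simp add: Diff_infty_one)
next
  case (Cons i w)
  have "word_eval Diff_infty X (pos_word (i # w)) t \<le> word_eval Diff_infty X (pos_word w) t"
    unfolding word_eval_pos_Cons[OF t] using Diff_infty_in_Icc[OF word_eval_X_closed t] by (rule X_le)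
  then show ?case using Cons.IH by linarith
qed

text \<open>All generators push to the left, so a displacement caused by one letter can never be
  undone by another.\<close>

lemma word_eval_pos_fixed_iff:
  assumes t: "t \<in> {0..1}"
  shows "word_eval Diff_infty X (pos_word w) t = t \<longleftrightarrow> (\<forall>i\<in>set w. X i t = t)"
proof (induction w)
  case Nil
  show ?case using t by (simp add: Diff_infty_one)
next
  case (Cons i w)
  let ?s = "word_eval Diff_infty X (pos_word w) t"
  have "X i ?s \<le> ?s"
    using Diff_infty_in_Icc[OF word_eval_X_closed t] by (rule X_le)
  moreover have "?s \<le> t" using t by (rule word_eval_pos_le)
  ultimately have "X i ?s = t \<longleftrightarrow> ?s = t \<and> X i t = t"
    by (metis order_antisym)
  then show ?case
    unfolding word_eval_pos_Cons[OF t] using Cons.IH by auto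
qed

text \<open>If \<open>m\<close> were absent from \<open>w\<close>, all letters of \<open>w\<close>
  would exceed \<open>m\<close> and fix the witness point from \<open>moved\<close>, while
  \<open>v\<close> moves it.\<close>

lemma min_index_mem:
  assumes eq: "word_eval Diff_infty X (pos_word v) = word_eval Diff_infty X (pos_word w)"
    and m: "m \<in> set v" "\<And>j. j \<in> set w \<Longrightarrow> m \<le> j"
  shows "m \<in> set w"
proof (rule ccontr)
  assume "m \<notin> set w"
  obtain t where t: "t \<in> {0..1}" "X m t \<noteq> t" "\<And>j. m < j \<Longrightarrow> X j t = t"
    using moved by blast
  have "\<forall>j\<in>set w. X j t = t"
    using t(3) m(2) \<open>m \<notin> set w\<close> by (metis le_neq_implies_less)
  then show False
    using word_eval_pos_fixed_iff[OF t(1)] eq m(1) t(2) by metis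
qed

text \<open>Equal values force the two words to share their least index; that generator is brought
  to the front of both and cancelled in the group.\<close>

lemma word_eval_pos_inject:
  "word_eval Diff_infty X (pos_word v) = word_eval Diff_infty X (pos_word w) \<Longrightarrow>
    thompson_eq (pos_word v) (pos_word w)"
proof (induction "length v" arbitrary: v w)
  case 0
  have "w = []"
  proof (rule ccontr)
    assume "w \<noteq> []"
    \<comment> \<open>The roles are exchanged here: the bound on the letters of \<open>v\<close> is
      vacuous because \<open>v\<close> is empty.\<close>
    then have "Min (set w) \<in> set v"
      using 0 by (intro min_index_mem[of w v]) auto
    then show False using 0 by simp
  qed
  then show ?case
    using 0 by (simp add: pres_eq.refl)
next
  case (Suc n)
  define m where "m = Min (set v \<union> set w)"
  have "set v \<union> set w \<noteq> {}" using Suc.hyps(2) by auto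
  then have "m \<in> set v \<union> set w"
    unfolding m_def by (intro Min_in) auto
  have le: "m \<le> j" if "j \<in> set v \<union> set w" for j
    unfolding m_def using that by (intro Min_le) auto
  have "m \<in> set v" "m \<in> set w"
    using \<open>m \<in> set v \<union> set w\<close> min_index_mem[OF Suc.prems] min_index_mem[OF Suc.prems[symmetric]] le
    by blast+
  then obtain v' w' where v': "length v = Suc (length v')" "thompson_eq (pos_word v) (pos_word (m # v'))"
    and w': "thompson_eq (pos_word w) (pos_word (m # w'))"
    using le by (metis thompson_eq_min_first UnCI)
  have "X m \<otimes>\<^bsub>Diff_infty\<^esub> word_eval Diff_infty X (pos_word v') =
      X m \<otimes>\<^bsub>Diff_infty\<^esub> word_eval Diff_infty X (pos_word w')"
    using word_eval_thompson_eq[OF v'(2)] word_eval_thompson_eq[OF w'] Suc.prems by simp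
  then have "word_eval Diff_infty X (pos_word v') = word_eval Diff_infty X (pos_word w')"
    using range_X X_closed by (simp add: word_eval_closed)
  then have "thompson_eq (pos_word v') (pos_word w')"
    using Suc.hyps v'(1) by simp
  from pres_eq_in_context[OF this, of "[(m, True)]" "[]"]
  have "thompson_eq (pos_word (m # v')) (pos_word (m # w'))"
    by simp
  then show ?case
    by (rule pres_eq.trans[OF v'(2) pres_eq.trans[OF _ pres_eq.sym[OF w']]])
qed

text \<open>Writing \<open>u\<close> as a fraction of \<open>P\<close> by \<open>N\<close>, a
  trivial value means that \<open>P\<close> and \<open>N\<close> have equal values, which reduces to
  positive words.\<close>

lemma word_eval_kernel:
  assumes "word_eval Diff_infty X u = \<one>\<^bsub>Diff_infty\<^esub>"
  shows "thompson_eq u []"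
proof -
  obtain P N where u: "thompson_eq u (pos_word P @ word_inv (pos_word N))"
    using thompson_eq_fraction by blast
  let ?eval = "word_eval Diff_infty X"
  have "?eval (pos_word P) \<otimes>\<^bsub>Diff_infty\<^esub> ?eval (word_inv (pos_word N)) =
      ?eval (pos_word N) \<otimes>\<^bsub>Diff_infty\<^esub> ?eval (word_inv (pos_word N))"
    using word_eval_thompson_eq[OF u] assms range_X
      word_eval_thompson_eq[OF pres_eq_word_inv_right[of _ "pos_word N"]]
    by (simp add: word_eval_append)
  then have "?eval (pos_word P) = ?eval (pos_word N)"
    using range_X by (simp add: word_eval_closed)
  then have "thompson_eq (pos_word P) (pos_word N)"
    by (rule word_eval_pos_inject)
  from pres_eq_in_context[OF this, of "[]" "word_inv (pos_word N)"]
  have "thompson_eq (pos_word P @ word_inv (pos_word N)) (pos_word N @ word_inv (pos_word N))"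
    by simp
  then show ?thesis
    by (rule pres_eq.trans[OF u pres_eq.trans[OF _ pres_eq_word_inv_right]])
qed

lemma thompson_F_iso_subgroup:
  "\<exists>H. subgroup H Diff_infty \<and> thompson_F \<cong> Diff_infty\<lparr>carrier := H\<rparr>"
  unfolding thompson_F_def
  using range_X word_eval_kernel
  by (intro presented_group_iso_subgroup[of X]) (auto intro: word_eval_thompson_eq
      pres_eq.rel[of _ _ _ "[]" "[]", simplified])

end

section \<open>The generators\<close>

text \<open>The first two generators determine the rest by conjugation with \<open>A\<close>, so the
  relations with \<open>i = 0\<close> are built in.\<close>

fun thompson_gen :: "(real \<Rightarrow> real) \<Rightarrow> (real \<Rightarrow> real) \<Rightarrow> nat \<Rightarrow> real \<Rightarrow> real" where
  "thompson_gen A B 0 = A"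
| "thompson_gen A B (Suc 0) = B"
| "thompson_gen A B (Suc (Suc k)) =
    inv\<^bsub>Diff_infty\<^esub> A \<otimes>\<^bsub>Diff_infty\<^esub> thompson_gen A B (Suc k) \<otimes>\<^bsub>Diff_infty\<^esub> A"

lemma (in group) conj_relation:
  assumes "a \<in> carrier G" "x \<in> carrier G" "y \<in> carrier G" "z \<in> carrier G" "x \<otimes> y = y \<otimes> z"
  shows "(inv a \<otimes> x \<otimes> a) \<otimes> (inv a \<otimes> y \<otimes> a) = (inv a \<otimes> y \<otimes> a) \<otimes> (inv a \<otimes> z \<otimes> a)"
proof -
  have conj_mult: "(inv a \<otimes> u \<otimes> a) \<otimes> (inv a \<otimes> v \<otimes> a) = inv a \<otimes> (u \<otimes> v) \<otimes> a"
    if "u \<in> carrier G" "v \<in> carrier G" for u v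
  proof -
    have "a \<otimes> (inv a \<otimes> (v \<otimes> a)) = v \<otimes> a"
      using that assms(1) by (simp add: m_assoc[symmetric])
    then show ?thesis
      using that assms(1) by (simp add: m_assoc)
  qed
  show ?thesis
    using assms by (simp add: conj_mult)
qed

locale thompson_generators =
  fixes A B :: "real \<Rightarrow> real" and b c :: real
  assumes A: "A \<in> carrier Diff_infty" and B: "B \<in> carrier Diff_infty"
    and bc: "0 < b" "b < c" "c < 1"
    and B_fixed: "t \<in> {0..b} \<Longrightarrow> B t = t"
    and B_less: "b < t \<Longrightarrow> t < 1 \<Longrightarrow> B t < t"
    and A_eq_B: "t \<in> {c..1} \<Longrightarrow> A t = B t"
    and A_less: "0 < t \<Longrightarrow> t < 1 \<Longrightarrow> A t < t"
    and A_A_c: "A (A c) \<le> b"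
    and A_0: "A 0 = 0" and A_1: "A 1 = 1"
begin

sublocale group Diff_infty
  by (rule group_Diff_infty)

abbreviation X :: "nat \<Rightarrow> real \<Rightarrow> real" where
  "X \<equiv> thompson_gen A B"

lemma X_closed: "X i \<in> carrier Diff_infty"
  by (induction i rule: induct_nat_012) (use A B in auto)

lemma A_le: "t \<in> {0..1} \<Longrightarrow> A t \<le> t"
  using A_less[of t] A_0 A_1 by (cases "t = 0 \<or> t = 1") (auto simp: less_imp_le)

lemma B_le: "t \<in> {0..1} \<Longrightarrow> B t \<le> t"
  using B_less[of t] B_fixed[of t] A_eq_B[of 1] A_1 bc
  by (cases "t \<le> b \<or> t = 1") (auto simp: less_imp_le)

section \<open>Iterates of \<open>A\<close> and the points moved by each generator\<close>

lemma A_pow_in: "t \<in> {0..1} \<Longrightarrow> (A ^^ k) t \<in> {0..1}"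
  by (induction k) (auto simp: Diff_infty_in_Icc[OF A] simp del: atLeastAtMost_iff)

lemma A_pow_le: "t \<in> {0..1} \<Longrightarrow> (A ^^ k) t \<le> t"
proof (induction k)
  case (Suc k)
  then show ?case using A_le[OF A_pow_in, of t k] by simp
qed simp

lemma A_pow_le_iff:
  "s \<in> {0..1} \<Longrightarrow> t \<in> {0..1} \<Longrightarrow> (A ^^ k) s \<le> (A ^^ k) t \<longleftrightarrow> s \<le> t"
  by (induction k) (simp_all add: Diff_infty_le_iff[OF A] A_pow_in del: atLeastAtMost_iff)

lemma A_pow_eq_iff:
  "s \<in> {0..1} \<Longrightarrow> t \<in> {0..1} \<Longrightarrow> (A ^^ k) s = (A ^^ k) t \<longleftrightarrow> s = t"
  using A_pow_le_iff[of s t k] A_pow_le_iff[of t s k] by (auto simp: eq_iff)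

lemma A_pow_surj: "y \<in> {0..1} \<Longrightarrow> \<exists>t\<in>{0..1}. (A ^^ k) t = y"
proof (induction k arbitrary: y)
  case (Suc k)
  let ?z = "(inv\<^bsub>Diff_infty\<^esub> A) y"
  have "?z \<in> {0..1}"
    using Diff_infty_in_Icc[OF inv_closed[OF A] Suc.prems] .
  then obtain t where "t \<in> {0..1}" "(A ^^ k) t = ?z"
    using Suc.IH by blast
  moreover have "A ?z = y"
    using Diff_infty_inv(2)[OF A Suc.prems] .
  ultimately show ?case by (intro bexI[of _ t]) simp_all
qed auto

lemma X_in: "t \<in> {0..1} \<Longrightarrow> X i t \<in> {0..1}"
  using X_closed by (rule Diff_infty_in_Icc)

lemma A_X:
  assumes "t \<in> {0..1}"
  shows "A (X (Suc (Suc k)) t) = X (Suc k) (A t)"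
proof -
  have "A t \<in> {0..1}" by (rule Diff_infty_in_Icc[OF A assms])
  then have "X (Suc (Suc k)) t = (inv\<^bsub>Diff_infty\<^esub> A) (X (Suc k) (A t))"
    by (simp only: thompson_gen.simps Diff_infty_mult[OF inv_closed[OF A] X_closed]
        Diff_infty_mult[OF m_closed[OF inv_closed[OF A] X_closed] A assms])
  then show ?thesis
    using Diff_infty_inv(2)[OF A X_in[OF \<open>A t \<in> {0..1}\<close>]] by simp
qed

text \<open>This says that \<open>X (Suc k)\<close> is \<open>B\<close> conjugated by the
  \<open>k\<close>-th power of \<open>A\<close>, in a form free of inverses.\<close>

lemma A_pow_X: "t \<in> {0..1} \<Longrightarrow> (A ^^ k) (X (Suc k) t) = B ((A ^^ k) t)"
proof (induction k arbitrary: t)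
  case (Suc k)
  have "(A ^^ Suc k) (X (Suc (Suc k)) t) = (A ^^ k) (X (Suc k) (A t))"
    using A_X[OF Suc.prems] by (simp only: funpow_Suc_right o_apply)
  also have "\<dots> = B ((A ^^ k) (A t))"
    using Suc.prems by (intro Suc.IH Diff_infty_in_Icc[OF A])
  finally show ?case
    by (simp only: funpow_Suc_right o_apply)
qed simp

lemma X_fixed:
  assumes "t \<in> {0..1}" "(A ^^ k) t \<le> b"
  shows "X (Suc k) t = t"
proof -
  have "B ((A ^^ k) t) = (A ^^ k) t"
    using A_pow_in[OF assms(1), of k] assms(2) by (intro B_fixed) auto
  then have "(A ^^ k) (X (Suc k) t) = (A ^^ k) t"
    using A_pow_X[OF assms(1), of k] by simp
  then show ?thesis
    using A_pow_eq_iff[OF X_in[OF assms(1)] assms(1)] by simp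
qed

lemma X_le:
  assumes "t \<in> {0..1}"
  shows "X i t \<le> t"
proof (cases i)
  case (Suc k)
  have "(A ^^ k) (X (Suc k) t) \<le> (A ^^ k) t"
    unfolding A_pow_X[OF assms] using A_pow_in[OF assms] by (rule B_le)
  then show ?thesis
    using A_pow_le_iff[OF X_in[OF assms] assms] Suc by simp
qed (simp add: A_le[OF assms])

text \<open>The witness is the point that the \<open>m\<close>-th iterate of \<open>A\<close> sends
  to \<open>b\<close>, the left end of the region moved by \<open>B\<close>. One iterate fewer
  leaves it above \<open>b\<close>, where \<open>B\<close> moves it; further iterates keep it at
  most \<open>b\<close>.\<close>

lemma X_moved: "\<exists>t\<in>{0..1}. X m t \<noteq> t \<and> (\<forall>j>m. X j t = t)"
proof (cases m)
  case 0
  have b: "b \<in> {0..1}" using bc by auto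
  have "X j b = b" if j: "0 < j" for j
  proof -
    obtain k where k: "j = Suc k" using j gr0_implies_Suc by blast
    show ?thesis unfolding k by (rule X_fixed[OF b A_pow_le[OF b]])
  qed
  moreover have "A b \<noteq> b" using A_less[of b] bc by auto
  ultimately show ?thesis
    using b unfolding 0 by (intro bexI[of _ b]) simp_all
next
  case (Suc k)
  have b: "b \<in> {0..1}" using bc by auto
  obtain t where t: "t \<in> {0..1}" "(A ^^ Suc k) t = b"
    using A_pow_surj[OF b] by blast
  let ?y = "(A ^^ k) t"
  have y: "?y \<in> {0..1}" "A ?y = b"
    using t A_pow_in by auto
  have "A b < A ?y" using A_less[of b] bc y(2) by auto
  then have "b < ?y" using Diff_infty_less_iff[OF A b y(1)] by simp
  moreover have "?y < 1"
    using y A_1 bc by (cases "?y = 1") auto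
  ultimately have "(A ^^ k) (X (Suc k) t) \<noteq> (A ^^ k) t"
    unfolding A_pow_X[OF t(1)] using B_less[of ?y] by simp
  then have "X m t \<noteq> t" unfolding Suc by metis
  moreover have "X j t = t" if "j > m" for j
  proof -
    define l where "l = j - Suc m"
    have j: "j = Suc (l + Suc k)" using that unfolding Suc l_def by linarith
    have "(A ^^ (l + Suc k)) t = (A ^^ l) b"
      unfolding funpow_add o_apply t(2) ..
    also have "\<dots> \<le> b" using b by (rule A_pow_le)
    finally show ?thesis
      unfolding j by (rule X_fixed[OF t(1)])
  qed
  ultimately show ?thesis using t(1) by blast
qed

text \<open>The pointwise form of the relations with \<open>i = 1\<close>. As \<open>0 < k\<close>,
  the iterate \<open>A ^^ Suc k\<close> sends \<open>c\<close> to at most \<open>b\<close>, so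
  \<open>X (Suc (Suc k))\<close> moves only points above \<open>c\<close>. There \<open>A\<close>
  and \<open>B\<close> agree, and conjugating by one or the other is the same.\<close>

lemma X_B:
  assumes t: "t \<in> {0..1}" and k: "0 < k"
  shows "X (Suc k) (B t) = B (X (Suc (Suc k)) t)"
proof -
  have c: "c \<in> {0..1}" using bc by auto
  obtain l where l: "k = Suc l" using k gr0_implies_Suc by blast
  have "(A ^^ Suc k) c = (A ^^ l) (A (A c))"
    unfolding l by (simp only: funpow_Suc_right o_apply)
  also have "\<dots> \<le> A (A c)"
    by (intro A_pow_le Diff_infty_in_Icc[OF A] c)
  finally have A_pow_c: "(A ^^ Suc k) c \<le> b"
    using A_A_c by simp
  have Bt: "B t \<in> {0..1}" using B t by (rule Diff_infty_in_Icc)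
  show ?thesis
  proof (cases "(A ^^ Suc k) t \<le> b")
    case True
    \<comment> \<open>Here both sides equal \<open>B t\<close>, provided that
      \<open>X (Suc k)\<close> fixes \<open>B t\<close>. Above \<open>c\<close> this point is
      \<open>A t\<close>; below \<open>c\<close> monotonicity bounds it by
      \<open>A c\<close>.\<close>
    have "(A ^^ k) (B t) \<le> b"
    proof (cases "c \<le> t")
      case True
      then have "B t = A t" using A_eq_B t by simp
      then show ?thesis
        using \<open>(A ^^ Suc k) t \<le> b\<close> by (simp only: funpow_Suc_right o_apply)
    next
      case False
      then have "B t \<le> B c" using Diff_infty_le_iff[OF B t c] by simp
      also have "B c = A c" using A_eq_B bc by simp
      finally have "(A ^^ k) (B t) \<le> (A ^^ k) (A c)"
        using A_pow_le_iff[OF Bt] Diff_infty_in_Icc[OF A c] by simp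
      then show ?thesis
        using A_pow_c by (simp only: funpow_Suc_right o_apply)
    qed
    then have "X (Suc k) (B t) = B t" using Bt by (intro X_fixed)
    moreover have "X (Suc (Suc k)) t = t" using t True by (rule X_fixed)
    ultimately show ?thesis by simp
  next
    case False
    have above_c: "s \<in> {c..1}" if "s \<in> {0..1}" "b < (A ^^ Suc k) s" for s
      using that A_pow_le_iff[OF that(1) c, of "Suc k"] A_pow_c by (cases "s \<le> c") auto
    let ?s = "X (Suc (Suc k)) t"
    have s: "?s \<in> {0..1}" using t by (rule X_in)
    \<comment> \<open>The image \<open>?s\<close> must also lie above \<open>c\<close> for
      \<open>B ?s = A ?s\<close>. Since \<open>B\<close> fixes \<open>b\<close> and is increasing,
      it maps the iterate of \<open>t\<close> to a point still above \<open>b\<close>.\<close>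
    have "B b < B ((A ^^ Suc k) t)"
      using Diff_infty_less_iff[OF B _ A_pow_in[OF t], of b "Suc k"] bc False by auto
    then have "b < (A ^^ Suc k) ?s"
      using A_pow_X[OF t, of "Suc k"] B_fixed[of b] bc by simp
    then have "B ?s = A ?s"
      using above_c[OF s] A_eq_B by simp
    also have "\<dots> = X (Suc k) (A t)" using t by (rule A_X)
    also have "A t = B t"
      using above_c[OF t] False A_eq_B by simp
    finally show ?thesis ..
  qed
qed

lemma X_rel:
  assumes "i < j"
  shows "X j \<otimes>\<^bsub>Diff_infty\<^esub> X i = X i \<otimes>\<^bsub>Diff_infty\<^esub> X (j + 1)"
proof -
  \<comment> \<open>For positive indices, conjugation by \<open>A\<close> raises every index by one,
    so induction reduces to the smaller index 1, which is \<open>X_B\<close>.\<close>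
  have *: "X (Suc j) \<otimes>\<^bsub>Diff_infty\<^esub> X (Suc i) = X (Suc i) \<otimes>\<^bsub>Diff_infty\<^esub> X (Suc (Suc j))"
    if "i < j" for i j
    using that
  proof (induction i arbitrary: j)
    case 0
    show ?case
    proof (rule Diff_infty_eqI)
      fix t :: real assume t: "t \<in> {0..1}"
      show "(X (Suc j) \<otimes>\<^bsub>Diff_infty\<^esub> X (Suc 0)) t = (X (Suc 0) \<otimes>\<^bsub>Diff_infty\<^esub> X (Suc (Suc j))) t"
        using X_B[OF t 0] unfolding Diff_infty_mult[OF X_closed X_closed t] by simp
    qed (intro m_closed X_closed)+
  next
    case (Suc i)
    then obtain l where l: "j = Suc l" "i < l" by (cases j) auto
    show ?case
      using conj_relation[OF A X_closed X_closed X_closed Suc.IH[OF l(2)]] l(1) by simp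
  qed
  obtain k where k: "j = Suc k" using assms by (cases j) auto
  show ?thesis
  proof (cases i)
    case 0
    \<comment> \<open>For \<open>i = 0\<close> the relation is the recursive equation of
      \<open>thompson_gen\<close> multiplied by \<open>A\<close> on the left.\<close>
    have "A \<otimes>\<^bsub>Diff_infty\<^esub> (inv\<^bsub>Diff_infty\<^esub> A \<otimes>\<^bsub>Diff_infty\<^esub> (X (Suc k) \<otimes>\<^bsub>Diff_infty\<^esub> A)) =
        X (Suc k) \<otimes>\<^bsub>Diff_infty\<^esub> A"
      using A X_closed by (simp add: m_assoc[symmetric])
    then show ?thesis
      using A X_closed by (simp add: 0 k m_assoc)
  next
    case (Suc i')
    then show ?thesis using *[of i' k] assms k by simp
  qed
qed

sublocale action: thompson_action X
  using X_closed X_rel X_le X_moved by (rule thompson_action.intro)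

end

section \<open>Two overlapping bumps\<close>

text \<open>The subtracted bump is positive exactly between \<open>a\<close> and \<open>d\<close>.
  Division by 8 keeps the slope at least 1/2, since the derivative of the undivided bump is at most
  4.\<close>

definition push :: "real \<Rightarrow> real \<Rightarrow> real \<Rightarrow> real" where
  "push a d x = x - flat 0 (x - a) * flat 0 (d - x) / 8"

lemma push_fixed: "x \<le> a \<or> d \<le> x \<Longrightarrow> push a d x = x"
  by (auto simp: push_def flat_nonpos)

lemma push_less: "a < x \<Longrightarrow> x < d \<Longrightarrow> push a d x < x"
  by (simp add: push_def flat_pos)

lemma push_le: "push a d x \<le> x"
  by (simp add: push_def flat_nonneg)

definition push_deriv :: "real \<Rightarrow> real \<Rightarrow> real \<Rightarrow> real" where
  "push_deriv a d x =
    1 - (1 / 8) * (flat 2 (x - a) * flat 0 (d - x) - flat 0 (x - a) * flat 2 (d - x))"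

lemma has_real_derivative_push: "(push a d has_real_derivative push_deriv a d x) (at x)"
proof -
  have flat: "(flat 0 has_real_derivative flat 2 y) (at y)" for y
    using has_real_derivative_flat[of 0 y] by (simp add: numeral_2_eq_2)
  have "((\<lambda>x. flat 0 (x - a)) has_real_derivative flat 2 (x - a) * 1) (at x)"
    by (rule DERIV_chain2[OF flat]) (auto intro!: derivative_eq_intros)
  moreover have "((\<lambda>x. flat 0 (d - x)) has_real_derivative flat 2 (d - x) * (-1)) (at x)"
    by (rule DERIV_chain2[OF flat]) (auto intro!: derivative_eq_intros)
  ultimately show ?thesis
    unfolding push_def push_deriv_def
    by (auto intro!: derivative_eq_intros simp: field_simps)
qed

lemma push_deriv_pos: "0 < push_deriv a d x"
proof -
  have "flat 2 (x - a) * flat 0 (d - x) \<le> 4 * 1"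
    by (intro mult_mono flat_2_le_4 flat_0_le_1 flat_nonneg) auto
  moreover have "0 \<le> flat 0 (x - a) * flat 2 (d - x)"
    by (simp add: flat_nonneg)
  ultimately show ?thesis
    by (simp add: push_deriv_def)
qed

lemma diff_upto_push_deriv: "diff_upto n UNIV (push_deriv a d)"
proof -
  have l: "diff_upto n UNIV (\<lambda>x. flat k (x - a))" for k
    by (rule diff_upto_compose[OF diff_upto_flat[of _ UNIV]
          diff_upto_diff[OF diff_upto_ident diff_upto_const]]) simp
  have r: "diff_upto n UNIV (\<lambda>x. flat k (d - x))" for k
    by (rule diff_upto_compose[OF diff_upto_flat[of _ UNIV]
          diff_upto_diff[OF diff_upto_const diff_upto_ident]]) simp
  show ?thesis
    unfolding push_deriv_def
    by (rule diff_upto_diff[OF diff_upto_const diff_upto_cmult[OF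
            diff_upto_diff[OF diff_upto_mult[OF l r] diff_upto_mult[OF l r]]]])
qed

lemma isCont_push: "isCont (push a d) x"
  using has_real_derivative_push by (rule DERIV_isCont)

lemma strict_mono_push: "strict_mono (push a d)"
  using DERIV_pos_imp_increasing[of _ _ "push a d"] has_real_derivative_push push_deriv_pos
  by (intro strict_monoI) blast

text \<open>Points are displaced left by at most 1/8, so \<open>y\<close> lies between the images of
  \<open>y\<close> and \<open>y + 1\<close>.\<close>

lemma surj_push: "surj (push a d)"
proof (rule surjI)
  fix y
  have "flat 0 (y + 1 - a) * flat 0 (d - (y + 1)) \<le> 1 * 1"
    by (intro mult_mono flat_0_le_1 flat_nonneg) auto
  then have "y \<le> push a d (y + 1)"
    by (simp add: push_def)
  then have "\<exists>x. push a d x = y"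
    using IVT[of "push a d" y y "y + 1"] push_le isCont_push by fastforce
  then show "push a d (SOME x. push a d x = y) = y"
    by (rule someI_ex)
qed

lemma push_in_Diff_infty:
  assumes "0 \<le> a" "d \<le> 1"
  shows "restrict (push a d) {0..1} \<in> carrier Diff_infty"
  using assms
  by (intro restrict_in_Diff_infty[OF has_real_derivative_push push_deriv_pos]
      diff_upto_push_deriv surj_push) (auto simp: push_fixed)

section \<open>Iterates of a push\<close>

lemma funpow_push_fixed: "x \<le> a \<or> d \<le> x \<Longrightarrow> (push a d ^^ n) x = x"
  by (induction n) (auto simp: push_fixed)

lemma funpow_push_le: "(push a d ^^ n) x \<le> x"
  by (induction n) (auto intro: order_trans[OF push_le])

lemma mono_funpow_push: "mono (push a d ^^ n)"
  by (simp add: mono_pow strict_mono_mono strict_mono_push)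

lemma funpow_push_less:
  assumes "a < x" "x < d" "0 < n"
  shows "(push a d ^^ n) x < x"
proof -
  obtain m where "n = Suc m" using assms(3) gr0_implies_Suc by blast
  then have "(push a d ^^ n) x = (push a d ^^ m) (push a d x)"
    by (simp add: funpow_swap1)
  also have "\<dots> \<le> push a d x" by (rule funpow_push_le)
  also have "\<dots> < x" using assms by (simp add: push_less)
  finally show ?thesis .
qed

text \<open>Otherwise the decreasing iterates converge to a fixed point between \<open>b\<close> and
  \<open>x\<close>, but \<open>push a d\<close> has no fixed point strictly between \<open>a\<close>
  and \<open>d\<close>.\<close>

lemma funpow_push_eventually_le:
  assumes "a < b" "x < d"
  shows "\<exists>n. (push a d ^^ n) x \<le> b"
proof (rule ccontr)
  assume "\<not> ?thesis"
  then have above: "b < (push a d ^^ n) x" for n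
    by (simp add: not_le)
  have "decseq (\<lambda>n. (push a d ^^ n) x)"
    by (simp add: decseq_Suc_iff push_le)
  then obtain L where L: "(\<lambda>n. (push a d ^^ n) x) \<longlonglongrightarrow> L"
    using decseq_convergent[of _ b] above by (metis less_imp_le)
  then have "(\<lambda>n. push a d ((push a d ^^ n) x)) \<longlonglongrightarrow> push a d L"
    by (rule isCont_tendsto_compose[OF isCont_push])
  moreover have "(\<lambda>n. push a d ((push a d ^^ n) x)) \<longlonglongrightarrow> L"
    using LIMSEQ_Suc[OF L] by simp
  ultimately have "push a d L = L"
    by (rule LIMSEQ_unique)
  moreover have "b \<le> L"
    using L above by (intro LIMSEQ_le_const) (auto intro: less_imp_le)
  moreover have "L \<le> x"
    using L funpow_push_le by (intro LIMSEQ_le_const2) auto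
  ultimately show False
    using push_less[of a L d] assms by auto
qed

lemma funpow_restrict:
  "(\<And>x. x \<in> S \<Longrightarrow> f x \<in> S) \<Longrightarrow> x \<in> S \<Longrightarrow> (restrict f S ^^ n) x = (f ^^ n) x"
  by (induction n arbitrary: x) (simp_all add: funpow_Suc_right del: funpow.simps(2))

text \<open>
  Replacing two bumps with overlapping supports \<open>[0, c]\<close> and \<open>[b, 1]\<close> by high powers
  makes their product \<open>A\<close> push \<open>c\<close> below \<open>b\<close> in two steps.
\<close>

lemma thompson_generators_exist: "\<exists>A B b c. thompson_generators A B b c"
proof -
  interpret group Diff_infty by (rule group_Diff_infty)
  let ?S = "{0..1::real}" and ?p = "push 0 (2/3)" and ?q = "push (1/3) 1"
  \<comment> \<open>A single application of \<open>?q\<close> brings 2/3 strictly inside the range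
    of \<open>?p\<close>, whose iterates then carry it down to 1/3.\<close>
  obtain N0 where "(?p ^^ N0) (?q (2/3)) \<le> 1/3"
    using funpow_push_eventually_le[of 0 "1/3" "?q (2/3)" "2/3"] push_less[of "1/3" "2/3" 1] by auto
  \<comment> \<open>The successor makes the exponent positive, as the strict inequalities for
    \<open>A\<close> and \<open>B\<close> require; one more push preserves the bound.\<close>
  moreover define N where "N = Suc N0"
  ultimately have N: "(?p ^^ N) (?q (2/3)) \<le> 1/3"
    using push_le[of 0 "2/3" "(?p ^^ N0) (?q (2/3))"] by simp
  let ?P = "restrict ?p ?S" and ?Q = "restrict ?q ?S"
  define A where "A = (?Q [^]\<^bsub>Diff_infty\<^esub> N) \<otimes>\<^bsub>Diff_infty\<^esub> (?P [^]\<^bsub>Diff_infty\<^esub> N)"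
  define B where "B = ?Q [^]\<^bsub>Diff_infty\<^esub> N"
  have P: "?P \<in> carrier Diff_infty" and Q: "?Q \<in> carrier Diff_infty"
    by (simp_all add: push_in_Diff_infty)
  have pS: "?p x \<in> ?S" and qS: "?q x \<in> ?S" if "x \<in> ?S" for x
    using Diff_infty_in_Icc[OF P that] Diff_infty_in_Icc[OF Q that] that by simp_all
  have Bt: "B t = (?q ^^ N) t" if "t \<in> ?S" for t
    unfolding B_def using Diff_infty_pow[OF Q that] funpow_restrict[OF qS that] by simp
  have Pt: "(?P [^]\<^bsub>Diff_infty\<^esub> N) t = (?p ^^ N) t" if "t \<in> ?S" for t
    using Diff_infty_pow[OF P that] funpow_restrict[OF pS that] by simp
  have At: "A t = (?q ^^ N) ((?p ^^ N) t)" if "t \<in> ?S" for t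
    using Diff_infty_mult[of B "?P [^]\<^bsub>Diff_infty\<^esub> N" t] P Q that Bt Pt
      Diff_infty_in_Icc[of "?P [^]\<^bsub>Diff_infty\<^esub> N" t]
    by (simp add: A_def B_def[symmetric]) (simp add: B_def)
  have AB: "A t = B t" if "t \<in> {2/3..1}" for t
    using that by (simp add: At Bt funpow_push_fixed)
  have "thompson_generators A B (1/3) (2/3)"
  proof (rule thompson_generators.intro)
    show A: "A \<in> carrier Diff_infty" "B \<in> carrier Diff_infty"
      using P Q by (auto simp: A_def B_def)
    show "B t = t" if "t \<in> {0..1/3}" for t
      using that by (simp add: Bt funpow_push_fixed)
    show "B t < t" if "1/3 < t" "t < 1" for t
      using that by (simp add: Bt funpow_push_less N_def del: funpow.simps)
    show "A t = B t" if "t \<in> {2/3..1}" for t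
      using that by (rule AB)
    show "A t < t" if "0 < t" "t < 1" for t
    \<comment> \<open>Below 2/3 the first factor \<open>?p\<close> already moves \<open>t\<close>
      strictly left; from 2/3 on it is the identity and \<open>?q\<close> does so.\<close>
    proof (cases "t < 2/3")
      case True
      have "A t \<le> (?p ^^ N) t"
        using that by (simp add: At funpow_push_le)
      also have "\<dots> < t"
        using that True by (simp add: funpow_push_less N_def del: funpow.simps)
      finally show ?thesis .
    next
      case False
      then show ?thesis
        using that AB[of t] by (simp add: Bt funpow_push_less N_def del: funpow.simps)
    qed
    show "A (A (2/3)) \<le> 1/3"
    proof -
      have "A (2/3) = (?q ^^ N) (2/3)"
        by (simp add: At funpow_push_fixed)
      also have "\<dots> = (?q ^^ N0) (?q (2/3))"
        by (simp add: N_def funpow_swap1)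
      also have "\<dots> \<le> ?q (2/3)" by (rule funpow_push_le)
      finally have "(?p ^^ N) (A (2/3)) \<le> (?p ^^ N) (?q (2/3))"
        by (rule monoD[OF mono_funpow_push])
      with N have "(?p ^^ N) (A (2/3)) \<le> 1/3" by linarith
      then show ?thesis
        \<comment> \<open>After \<open>?p ^^ N\<close> the point is at most 1/3, where
          \<open>?q\<close> is the identity, so the bound carries over to
          \<open>A (A (2/3))\<close>.\<close>
        using Diff_infty_in_Icc[OF A(1), of "2/3"] by (simp add: At[of "A _"] funpow_push_fixed)
    qed
  qed (auto simp: At funpow_push_fixed)
  then show ?thesis by blast
qed

theorem corollary1p2:
  shows "\<exists>H. subgroup H Diff_infty \<and> thompson_F \<cong> Diff_infty\<lparr>carrier := H\<rparr>"
proof -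
  obtain A B b c where "thompson_generators A B b c"
    using thompson_generators_exist by blast
  then interpret thompson_generators A B b c .
  show ?thesis by (rule action.thompson_F_iso_subgroup)
qed

end
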